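(* Let $P\subseteq\mathbb{N}$ and let $(\Sigma_P,\sigma_P)$ be the associated spacing shift. If the topological entropy satisfies $h_{\sigma_P}>0$, then $P$ is a $\Delta^*$-set.
   Context: $\mathbb{N}=\{1,2,3,\dots\}$. Let $\Sigma=\prod_{i=0}^{\infty}\{0,1\}$ be the one-sided full shift on two symbols with shift map $\sigma$, $(\sigma s)_i=s_{i+1}$. For $P\subseteq\mathbb{N}$ the spacing shift is the subshift $\Sigma_P=\{s\in\Sigma:\ s_i=s_j=1\Rightarrow |i-j|\in P\cup\{0\}\}$, and $\sigma_P$ is the restriction of $\sigma$ to $\Sigma_P$; $h_{\sigma_P}$ is its topological entropy. A set $D\subseteq\mathbb{N}$ is a $\Delta$-set if there is a (strictly) increasing sequence of natural numbers $S=(s_n)_{n\in\mathbb{N}}$ with $\Delta(S)=\{s_i-s_j:\ i>j\}\subseteq D$. A set $G\subseteq\mathbb{N}$ is a $\Delta^*$-set if $G\cap D\neq\emptyset$ for every $\Delta$-set $D$. *)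

theory Defs
  imports "HOL-Analysis.Analysis"
begin

section \<open>Topological entropy\<close>

definition open_cover :: "'a topology \<Rightarrow> 'a set set \<Rightarrow> bool" where
  "open_cover X \<U> \<longleftrightarrow> (\<forall>U\<in>\<U>. openin X U) \<and> \<Union>\<U> = topspace X"

definition min_subcover_card :: "'a topology \<Rightarrow> 'a set set \<Rightarrow> nat" where
  "min_subcover_card X \<U> =
     (LEAST k. \<exists>\<F>\<subseteq>\<U>. finite \<F> \<and> card \<F> = k \<and> \<Union>\<F> = topspace X)"

definition iterated_join :: "'a topology \<Rightarrow> ('a \<Rightarrow> 'a) \<Rightarrow> 'a set set \<Rightarrow> nat \<Rightarrow> 'a set set" where
  "iterated_join X T \<U> n =
     {topspace X \<inter> (\<Inter>i<n. (T ^^ i) -` V i) | V. \<forall>i<n. V i \<in> \<U>}"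

text \<open>Entropy in the sense of Adler, Konheim and McAndrew, meant for a nonempty compact space
  \<open>X\<close> and a continuous self-map \<open>T\<close> of \<open>X\<close>; the limit then exists by subadditivity.\<close>

definition cover_entropy :: "'a topology \<Rightarrow> ('a \<Rightarrow> 'a) \<Rightarrow> 'a set set \<Rightarrow> real" where
  "cover_entropy X T \<U> =
     lim (\<lambda>n. ln (real (min_subcover_card X (iterated_join X T \<U> n))) / real n)"

definition topological_entropy :: "'a topology \<Rightarrow> ('a \<Rightarrow> 'a) \<Rightarrow> ereal" where
  "topological_entropy X T = (SUP \<U>\<in>{\<U>. open_cover X \<U>}. ereal (cover_entropy X T \<U>))"

section \<open>Spacing shifts\<close>

definition full_shift :: "(nat \<Rightarrow> nat) topology" where
  "full_shift = product_topology (\<lambda>_. discrete_topology {0, 1}) UNIV"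

definition shift :: "(nat \<Rightarrow> nat) \<Rightarrow> (nat \<Rightarrow> nat)" where
  "shift s = (\<lambda>i. s (i + 1))"

definition spacing_space :: "nat set \<Rightarrow> (nat \<Rightarrow> nat) set" where
  "spacing_space P = {s \<in> topspace full_shift.
     \<forall>i j. s i = 1 \<and> s j = 1 \<longrightarrow> nat \<bar>int i - int j\<bar> \<in> P \<union> {0}}"

definition spacing_shift :: "nat set \<Rightarrow> (nat \<Rightarrow> nat) topology" where
  "spacing_shift P = subtopology full_shift (spacing_space P)"

lemma topspace_spacing_shift: "topspace (spacing_shift P) = spacing_space P"
  by (auto simp: spacing_shift_def spacing_space_def)

text \<open>By invariance, \<open>shift\<close> itself can be used as the self-map of \<open>spacing_shift P\<close>.\<close>

lemma shift_in_spacing_space: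
  assumes "s \<in> spacing_space P"
  shows "shift s \<in> spacing_space P"
proof -
  have "nat \<bar>int i - int j\<bar> \<in> P \<union> {0}" if "s (i + 1) = 1" "s (j + 1) = 1" for i j
  proof -
    have "nat \<bar>int (i + 1) - int (j + 1)\<bar> \<in> P \<union> {0}"
      using assms that unfolding spacing_space_def by blast
    then show ?thesis by simp
  qed
  moreover have "shift s \<in> topspace full_shift"
    using assms by (auto simp: spacing_space_def full_shift_def shift_def PiE_iff)
  ultimately show ?thesis
    by (auto simp: spacing_space_def shift_def)
qed

section \<open>Difference sets\<close>

text \<open>The natural numbers start at 1 here, so all sets below consist of positive integers.
  Sequences are indexed from 0, which does not change the sets of differences.\<close>

definition differences :: "(nat \<Rightarrow> nat) \<Rightarrow> nat set" where
  "differences s = {s i - s j | i j. i > j}"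

definition Delta_set :: "nat set \<Rightarrow> bool" where
  "Delta_set D \<longleftrightarrow> D \<subseteq> {1..} \<and>
     (\<exists>s. strict_mono s \<and> range s \<subseteq> {1..} \<and> differences s \<subseteq> D)"

definition Delta_star_set :: "nat set \<Rightarrow> bool" where
  "Delta_star_set G \<longleftrightarrow> G \<subseteq> {1..} \<and> (\<forall>D. Delta_set D \<longrightarrow> G \<inter> D \<noteq> {})"

end

theory Submission
  imports Defs "HOL-Real_Asymp.Real_Asymp"
begin

text \<open>If \<open>P\<close> misses a difference set \<open>\<Delta>(S)\<close>, then for every point of the spacing shift the translates
  of its set of ones by the elements of \<open>S\<close> are pairwise disjoint. So the ones have density at most
  \<open>1/N\<close> for every \<open>N\<close>, uniformly over all points, and a count of sparse subsets shows that the number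
  of words of length \<open>n\<close> is subexponential. By compactness, the number of words bounds the size of a
  minimal subcover of any iterated join, so the entropy vanishes.\<close>

section \<open>Sparse sets\<close>

text \<open>A common point of \<open>s i + A\<close> and \<open>s j + A\<close> would make
  \<open>s j - s i\<close> a difference within \<open>A\<close>. So the first \<open>N\<close>
  translates are disjoint copies of \<open>A\<close>, all inside
  \<open>{..<L + s N}\<close>.\<close>

lemma card_mult_le_if_translates_disjoint:
  fixes s :: "nat \<Rightarrow> nat"
  assumes diff: "\<And>a b. a \<in> A \<Longrightarrow> b \<in> A \<Longrightarrow> a < b \<Longrightarrow> b - a \<notin> differences s"
    and s: "strict_mono s" and A: "A \<subseteq> {..<L}"
  shows "N * card A \<le> L + s N"
proof -
  have fin: "finite A"
    using A finite_subset by blast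
  have less: "s i < s j" if "i < j" for i j
    using s that by (simp add: strict_mono_less)
  have disj: "(+) (s i) ` A \<inter> (+) (s j) ` A = {}" if "i < j" for i j
  proof (rule ccontr)
    assume "(+) (s i) ` A \<inter> (+) (s j) ` A \<noteq> {}"
    then obtain a b where ab: "a \<in> A" "b \<in> A" "s i + b = s j + a"
      by auto
    then have "a < b" "b - a = s j - s i"
      using less[OF that] by linarith+
    then show False
      using diff[OF ab(1,2)] that by (auto simp: differences_def)
  qed
  have "card (\<Union>k<N. (+) (s k) ` A) = (\<Sum>k<N. card ((+) (s k) ` A))"
  proof (intro card_UN_disjoint ballI impI)
    fix i j :: nat assume "i \<noteq> j"
    then consider "i < j" | "j < i" by linarith
    then show "(+) (s i) ` A \<inter> (+) (s j) ` A = {}"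
      by cases (use disj in blast)+
  qed (use fin in auto)
  also have "\<dots> = N * card A"
    by (simp add: card_image)
  finally have "N * card A = card (\<Union>k<N. (+) (s k) ` A)" ..
  also have "\<dots> \<le> card {..<L + s N}"
  proof (rule card_mono)
    have "s k + a < L + s N" if "k < N" "a \<in> A" for k a
      using less[OF that(1)] A that(2) by fastforce
    then show "(\<Union>k<N. (+) (s k) ` A) \<subseteq> {..<L + s N}"
      by auto
  qed simp
  finally show ?thesis by simp
qed

text \<open>The sum of \<open>N\<^sup>-\<close>\<open>card B\<close> over all \<open>B \<subseteq> {..<L}\<close> is \<open>(1 + 1/N)\<close> to the power \<open>L\<close>, and each small \<open>B\<close>
  contributes at least \<open>N\<close> to the power \<open>-k\<close>.\<close>

lemma card_small_subsets_le:
  assumes "N \<ge> 1"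
  shows "real (card {B. B \<subseteq> {..<L} \<and> card B \<le> k}) \<le> real N ^ k * (1 + 1 / real N) ^ L"
proof -
  let ?S = "{B. B \<subseteq> {..<L} \<and> card B \<le> k}" and ?t = "1 / real N"
  have "real (card ?S) * ?t ^ k = (\<Sum>B\<in>?S. ?t ^ k)"
    by simp
  also have "\<dots> \<le> (\<Sum>B\<in>?S. ?t ^ card B)"
    using assms by (intro sum_mono power_decreasing) auto
  also have "\<dots> \<le> (\<Sum>B\<in>Pow {..<L}. ?t ^ card B)"
    by (intro sum_mono2) auto
  \<comment> \<open>Expanding the product of \<open>L\<close> factors \<open>?t + 1\<close> yields
    one term for each subset of \<open>{..<L}\<close>.\<close>
  also have "\<dots> = (1 + ?t) ^ L"
    using prod_add[of "{..<L}" "\<lambda>_. ?t" "\<lambda>_. 1"] by (simp add: add.commute)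
  finally show ?thesis
    using assms by (simp add: power_one_over field_simps)
qed

text \<open>The preceding count is applied with \<open>k = (L + c) div N\<close>. For fixed
  \<open>N\<close> and \<open>c\<close> the bound divided by \<open>L\<close> tends to
  \<open>(ln N + 1) / N\<close>, which is small for large \<open>N\<close>.\<close>

lemma ln_card_sparse_subsets_le:
  assumes "N \<ge> 1"
  shows "ln (real (card {B. B \<subseteq> {..<L} \<and> N * card B \<le> L + c}))
    \<le> (real L + real c) / real N * ln (real N) + real L / real N"
proof -
  let ?S = "{B. B \<subseteq> {..<L} \<and> N * card B \<le> L + c}" and ?k = "(L + c) div N"
  have "finite ?S"
    by (rule finite_subset[of _ "Pow {..<L}"]) auto
  \<comment> \<open>The empty set makes the count positive, as monotonicity of \<open>ln\<close>
    requires.\<close>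
  moreover have "{} \<in> ?S"
    by simp
  ultimately have pos: "0 < card ?S"
    using card_gt_0_iff by blast
  have "?S = {B. B \<subseteq> {..<L} \<and> card B \<le> ?k}"
    using assms by (simp add: less_eq_div_iff_mult_less_eq mult.commute)
  then have "real (card ?S) \<le> real N ^ ?k * (1 + 1 / real N) ^ L"
    using card_small_subsets_le[OF assms] by simp
  then have "ln (real (card ?S)) \<le> ln (real N ^ ?k * (1 + 1 / real N) ^ L)"
    using pos by (subst ln_le_cancel_iff) (use assms in \<open>simp_all add: add_pos_nonneg\<close>)
  also have "\<dots> = real ?k * ln (real N) + real L * ln (1 + 1 / real N)"
  proof -
    have "0 < 1 + 1 / real N"
      by (simp add: add_pos_nonneg)
    then show ?thesis
      using assms by (simp add: ln_mult_pos ln_realpow)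
  qed
  also have "\<dots> \<le> (real L + real c) / real N * ln (real N) + real L * (1 / real N)"
  proof (intro add_mono mult_right_mono mult_left_mono)
    show "real ?k \<le> (real L + real c) / real N"
      using of_nat_div_le_of_nat[of "L + c" N, where 'a = real] by simp
    show "ln (1 + 1 / real N) \<le> 1 / real N"
      by (rule ln_add_one_self_le_self) simp
  qed (use assms in auto)
  finally show ?thesis by simp
qed

section \<open>Cylinders\<close>

definition cylinder :: "nat \<Rightarrow> (nat \<Rightarrow> nat) \<Rightarrow> (nat \<Rightarrow> nat) set" where
  "cylinder m x = {s. \<forall>i<m. s i = x i}"

lemma topspace_full_shift: "topspace full_shift = {s. \<forall>i. s i \<in> {0, 1}}"
  by (simp add: full_shift_def PiE_UNIV_domain Pi_def)

lemma openin_full_shift_cylinder: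
  "openin full_shift (topspace full_shift \<inter> cylinder m x)"
proof -
  \<comment> \<open>Since \<open>x\<close> is arbitrary, \<open>x i\<close> may not be a symbol; the
    intersection with \<open>{0, 1}\<close> keeps each factor an open subset of the discrete space,
    possibly empty.\<close>
  let ?X = "\<lambda>i. if i < m then {0, 1} \<inter> {x i} else {0, 1}"
  have "openin full_shift (Pi\<^sub>E UNIV ?X)"
    unfolding full_shift_def
  proof (rule product_topology_basis)
    show "finite {i. ?X i \<noteq> topspace (discrete_topology {0, 1})}"
      by (rule finite_subset[of _ "{..<m}"]) auto
  qed auto
  also have "Pi\<^sub>E UNIV ?X = topspace full_shift \<inter> cylinder m x"
    unfolding topspace_full_shift cylinder_def PiE_UNIV_domain Pi_def by (auto split: if_splits)
  finally show ?thesis .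
qed

lemma full_shift_open_contains_cylinder:
  assumes "openin full_shift U" "x \<in> U"
  obtains m where "topspace full_shift \<inter> cylinder m x \<subseteq> U"
proof -
  obtain X where X: "x \<in> Pi\<^sub>E UNIV X" "finite {i. X i \<noteq> {0, 1}}" "Pi\<^sub>E UNIV X \<subseteq> U"
    using product_topology_open_contains_basis[OF assms[unfolded full_shift_def]] by auto
  then obtain m where m: "{i. X i \<noteq> {0, 1}} \<subseteq> {..<m}"
    using finite_nat_iff_bounded by blast
  have "s \<in> Pi\<^sub>E UNIV X" if s: "s \<in> topspace full_shift \<inter> cylinder m x" for s
  proof -
    have "s i \<in> X i" for i
    proof (cases "X i = {0, 1}")
      case True
      then show ?thesis using s unfolding topspace_full_shift by blast
    next
      case False
      then have "s i = x i"
        using m s unfolding cylinder_def by blast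
      then show ?thesis using X(1) by (simp add: PiE_UNIV_domain Pi_iff)
    qed
    then show ?thesis by auto
  qed
  then have "topspace full_shift \<inter> cylinder m x \<subseteq> U"
    using X(3) by blast
  then show ?thesis
    by (rule that)
qed

text \<open>A forbidden distance is witnessed by two coordinates, hence by a whole cylinder. So the
  complement is open, and a closed subspace of the compact full shift is compact.\<close>

lemma compact_space_spacing_shift: "compact_space (spacing_shift P)"
proof -
  let ?C = "topspace full_shift - spacing_space P"
  have "openin full_shift ?C"
  proof (subst openin_subopen, intro ballI)
    fix s assume s: "s \<in> ?C"
    then obtain i j where ij: "s i = 1" "s j = 1" "nat \<bar>int i - int j\<bar> \<notin> P \<union> {0}"
      by (auto simp: spacing_space_def)
    let ?T = "topspace full_shift \<inter> cylinder (Suc (max i j)) s"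
    have "t \<notin> spacing_space P" if "t \<in> ?T" for t
    proof -
      have "t i = 1" "t j = 1"
        using that ij by (auto simp: cylinder_def)
      then show ?thesis
        using ij(3) by (auto simp: spacing_space_def)
    qed
    then have "?T \<subseteq> ?C"
      by blast
    moreover have "s \<in> ?T"
      using s by (simp add: cylinder_def)
    ultimately show "\<exists>T. openin full_shift T \<and> s \<in> T \<and> T \<subseteq> ?C"
      using openin_full_shift_cylinder by blast
  qed
  moreover have "spacing_space P \<subseteq> topspace full_shift"
    by (auto simp: spacing_space_def)
  ultimately have "closedin full_shift (spacing_space P)"
    by (simp add: closedin_def)
  moreover have "compact_space full_shift"
    by (auto simp: full_shift_def compact_space_product_topology compact_space_discrete_topology)
  ultimately show ?thesis
    unfolding spacing_shift_def
    by (intro compact_space_subtopology closedin_compact_space)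
qed

text \<open>A Lebesgue number for the cover, in terms of cylinders.\<close>

lemma spacing_shift_cover_lebesgue:
  assumes "open_cover (spacing_shift P) \<U>"
  obtains m where "\<And>x. x \<in> spacing_space P \<Longrightarrow> \<exists>U\<in>\<U>. spacing_space P \<inter> cylinder m x \<subseteq> U"
proof -
  let ?X = "spacing_space P"
  have sub: "?X \<subseteq> topspace full_shift"
    by (auto simp: spacing_space_def)
  have "\<exists>m. \<exists>U\<in>\<U>. ?X \<inter> cylinder m x \<subseteq> U" if x: "x \<in> ?X" for x
  proof -
    obtain U where U: "U \<in> \<U>" "x \<in> U" "openin (spacing_shift P) U"
      using assms x unfolding open_cover_def topspace_spacing_shift by blast
    then obtain T where T: "openin full_shift T" "U = T \<inter> ?X"
      unfolding spacing_shift_def openin_subtopology by blast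
    obtain m where "topspace full_shift \<inter> cylinder m x \<subseteq> T"
      using full_shift_open_contains_cylinder[OF T(1), of x] U(2) T(2) by blast
    then show ?thesis
      using T(2) U(1) sub by blast
  qed
  then obtain m where m: "\<And>x. x \<in> ?X \<Longrightarrow> \<exists>U\<in>\<U>. ?X \<inter> cylinder (m x) x \<subseteq> U"
    by metis
  let ?\<C> = "(\<lambda>x. ?X \<inter> cylinder (m x) x) ` ?X"
  have "openin (spacing_shift P) C" if "C \<in> ?\<C>" for C
  proof -
    obtain x where "C = ?X \<inter> cylinder (m x) x"
      using \<open>C \<in> ?\<C>\<close> by blast
    then have "C = (topspace full_shift \<inter> cylinder (m x) x) \<inter> ?X"
      using sub by blast
    then show ?thesis
      unfolding spacing_shift_def openin_subtopology
      using openin_full_shift_cylinder by blast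
  qed
  moreover have "\<Union>?\<C> = topspace (spacing_shift P)"
    by (auto simp: topspace_spacing_shift cylinder_def)
  ultimately obtain \<F> where \<F>: "finite \<F>" "\<F> \<subseteq> ?\<C>" "\<Union>\<F> = topspace (spacing_shift P)"
    using compact_space_spacing_shift[of P] unfolding compact_space by meson
  then obtain F where F: "finite F" "F \<subseteq> ?X" "\<F> = (\<lambda>x. ?X \<inter> cylinder (m x) x) ` F"
    by (meson finite_subset_image)
  show ?thesis
  proof (rule that)
    fix y assume "y \<in> ?X"
    then obtain x where x: "x \<in> F" "y \<in> cylinder (m x) x"
      using \<F>(3) F(3) by (auto simp: topspace_spacing_shift)
    \<comment> \<open>The longest of the finitely many cylinders gives the uniform length:
      \<open>y\<close> agrees with \<open>x\<close> below \<open>m x\<close>, so a cylinder around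
      \<open>y\<close> at least that long stays inside the one around \<open>x\<close>.\<close>
    have "m x \<le> Max (m ` F)"
      using x F(1) by simp
    then have "cylinder (Max (m ` F)) y \<subseteq> cylinder (m x) x"
      using x(2) by (fastforce simp: cylinder_def)
    then show "\<exists>U\<in>\<U>. ?X \<inter> cylinder (Max (m ` F)) y \<subseteq> U"
      using m[of x] x(1) F(2) by blast
  qed
qed

section \<open>Entropy\<close>

text \<open>Encodes the initial word of length \<open>L\<close> of a 0-1 sequence as a subset of
  \<open>{..<L}\<close>, so that counting words becomes counting subsets.\<close>

definition ones :: "nat \<Rightarrow> (nat \<Rightarrow> nat) \<Rightarrow> nat set" where
  "ones L s = {i. i < L \<and> s i = 1}"

lemma funpow_shift: "(shift ^^ i) s = (\<lambda>j. s (i + j))"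
  by (induction i arbitrary: s) (simp_all add: shift_def funpow_swap1)

lemma funpow_shift_in_spacing_space: "s \<in> spacing_space P \<Longrightarrow> (shift ^^ i) s \<in> spacing_space P"
  by (induction i) (auto intro: shift_in_spacing_space)

lemma min_subcover_card_le:
  assumes "\<F> \<subseteq> \<U>" "finite \<F>" "\<Union>\<F> = topspace X"
  shows "min_subcover_card X \<U> \<le> card \<F>"
  unfolding min_subcover_card_def by (rule Least_le) (use assms in blast)

text \<open>The first \<open>n + m\<close> symbols determine the first \<open>m\<close> symbols of
  each of the iterates \<open>0, ..., n - 1\<close>. Hence all points sharing such a word fit into
  one member of the join, and one member per word suffices.\<close>

lemma min_subcover_card_spacing_shift_le:
  assumes m: "\<And>x. x \<in> spacing_space P \<Longrightarrow> \<exists>U\<in>\<U>. spacing_space P \<inter> cylinder m x \<subseteq> U"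
  shows "min_subcover_card (spacing_shift P) (iterated_join (spacing_shift P) shift \<U> n)
    \<le> card (ones (n + m) ` spacing_space P)"
proof -
  let ?X = "spacing_space P" and ?J = "iterated_join (spacing_shift P) shift \<U> n"
  let ?Q = "ones (n + m) ` ?X"
  have "\<exists>W\<in>?J. \<forall>s\<in>?X. ones (n + m) s = ones (n + m) x \<longrightarrow> s \<in> W" if x: "x \<in> ?X" for x
  proof -
    have "\<forall>i. \<exists>U\<in>\<U>. ?X \<inter> cylinder m ((shift ^^ i) x) \<subseteq> U"
      using m funpow_shift_in_spacing_space[OF x] by blast
    then obtain V where V: "\<And>i. V i \<in> \<U>" "\<And>i. ?X \<inter> cylinder m ((shift ^^ i) x) \<subseteq> V i"
      by metis
    let ?W = "topspace (spacing_shift P) \<inter> (\<Inter>i<n. (shift ^^ i) -` V i)"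
    have "s \<in> ?W" if s: "s \<in> ?X" "ones (n + m) s = ones (n + m) x" for s
    proof -
      have eq: "s j = x j" if "j < n + m" for j
      proof -
        have "s j \<in> {0, 1}" "x j \<in> {0, 1}"
          using s(1) x unfolding spacing_space_def topspace_full_shift by blast+
        moreover have "s j = 1 \<longleftrightarrow> x j = 1"
          using s(2) that by (auto simp: ones_def)
        ultimately show ?thesis by auto
      qed
      have "(shift ^^ i) s \<in> V i" if "i < n" for i
      proof -
        have "(shift ^^ i) s \<in> cylinder m ((shift ^^ i) x)"
          using eq that by (simp add: cylinder_def funpow_shift)
        then show ?thesis
          using V(2) funpow_shift_in_spacing_space[OF s(1)] by blast
      qed
      then show ?thesis
        using s(1) by (auto simp: topspace_spacing_shift)
    qed
    moreover have "?W \<in> ?J"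
      unfolding iterated_join_def using V(1) by blast
    ultimately show ?thesis by blast
  qed
  \<comment> \<open>The member of the join is chosen per word rather than per point, so that at most
    \<open>card ?Q\<close> members are used.\<close>
  then have "\<forall>B\<in>?Q. \<exists>W. W \<in> ?J \<and> (\<forall>s\<in>?X. ones (n + m) s = B \<longrightarrow> s \<in> W)"
    by blast
  then obtain g where g: "\<And>B. B \<in> ?Q \<Longrightarrow> g B \<in> ?J"
    "\<And>s. s \<in> ?X \<Longrightarrow> s \<in> g (ones (n + m) s)"
    by (metis imageI)
  have fin: "finite ?Q"
    by (rule finite_subset[of _ "Pow {..<n + m}"]) (auto simp: ones_def)
  have "\<Union>?J \<subseteq> ?X"
    by (auto simp: iterated_join_def topspace_spacing_shift)
  then have "\<Union>(g ` ?Q) = topspace (spacing_shift P)"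
    using g unfolding topspace_spacing_shift by fastforce
  then have "min_subcover_card (spacing_shift P) ?J \<le> card (g ` ?Q)"
    using fin g(1) by (intro min_subcover_card_le) auto
  also have "\<dots> \<le> card ?Q"
    using fin by (rule card_image_le)
  finally show ?thesis .
qed

text \<open>Words of length \<open>n + m\<close> have at most \<open>(n + m + s N) / N\<close> ones,
  for every \<open>N\<close>. Thus the growth rate is at most \<open>(ln N + 1) / N\<close>, and
  \<open>N\<close> is arbitrary.\<close>

lemma cover_entropy_spacing_shift_eq_0:
  assumes cover: "open_cover (spacing_shift P) \<U>"
    and s: "strict_mono s" "P \<inter> differences s = {}"
  shows "cover_entropy (spacing_shift P) shift \<U> = 0"
proof -
  obtain m where m: "\<And>x. x \<in> spacing_space P \<Longrightarrow> \<exists>U\<in>\<U>. spacing_space P \<inter> cylinder m x \<subseteq> U"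
    using spacing_shift_cover_lebesgue[OF cover] by blast
  define M where
    "M n = min_subcover_card (spacing_shift P) (iterated_join (spacing_shift P) shift \<U> n)" for n
  have sparse: "N * card (ones L x) \<le> L + s N" if x: "x \<in> spacing_space P" for N L x
  proof (rule card_mult_le_if_translates_disjoint[OF _ s(1)])
    fix a b assume ab: "a \<in> ones L x" "b \<in> ones L x" "a < b"
    then have "nat \<bar>int b - int a\<bar> \<in> P \<union> {0}"
      using x unfolding spacing_space_def ones_def by blast
    moreover have "nat \<bar>int b - int a\<bar> = b - a"
      using ab(3) by simp
    ultimately show "b - a \<notin> differences s"
      using s(2) ab(3) by auto
  qed (auto simp: ones_def)
  have ln_M: "ln (real (M n)) \<le>
      (real (n + m) + real (s N)) / real N * ln (real N) + real (n + m) / real N"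
    if N: "N \<ge> 1" for n N
  \<comment> \<open>Here \<open>ln 0 = 0\<close>, and the right-hand side is nonnegative because
    \<open>N\<close> is at least 1.\<close>
  proof (cases "M n = 0")
    case True
    then show ?thesis using N by simp
  next
    case False
    let ?S = "{B. B \<subseteq> {..<n + m} \<and> N * card B \<le> (n + m) + s N}"
    have "M n \<le> card (ones (n + m) ` spacing_space P)"
      unfolding M_def by (rule min_subcover_card_spacing_shift_le[OF m])
    also have "\<dots> \<le> card ?S"
    proof (rule card_mono)
      show "finite ?S"
        by (rule finite_subset[of _ "Pow {..<n + m}"]) auto
      show "ones (n + m) ` spacing_space P \<subseteq> ?S"
        using sparse by (auto simp: ones_def)
    qed
    finally have "ln (real (M n)) \<le> ln (real (card ?S))"
      using False by simp
    also have "\<dots> \<le> (real (n + m) + real (s N)) / real N * ln (real N) + real (n + m) / real N"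
      by (rule ln_card_sparse_subsets_le[OF N])
    finally show ?thesis .
  qed
  \<comment> \<open>Genuine convergence is shown, since \<open>lim\<close> has a known value only
    then.\<close>
  have "(\<lambda>n. ln (real (M n)) / real n) \<longlonglongrightarrow> 0"
  proof (rule order_tendstoI)
    fix a :: real assume "a < 0"
    moreover have "0 \<le> ln (real (M n)) / real n" for n
      by (cases "M n = 0") auto
    ultimately show "\<forall>\<^sub>F n in sequentially. a < ln (real (M n)) / real n"
      by (intro always_eventually allI) (rule less_le_trans)
  next
    fix a :: real assume a: "0 < a"
    have "(\<lambda>N. (ln (real N) + 1) / real N) \<longlonglongrightarrow> 0"
      by real_asymp
    then have "\<forall>\<^sub>F N in sequentially. (ln (real N) + 1) / real N < a"
      using a by (rule order_tendstoD)
    \<comment> \<open>\<open>N\<close> is fixed before \<open>n\<close> grows, so that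
      \<open>m\<close> and \<open>s N\<close> are constants that vanish after division by
      \<open>n\<close>.\<close>
    then obtain N where N: "N \<ge> 1" "(ln (real N) + 1) / real N < a"
      using eventually_conj[OF _ eventually_ge_at_top[of 1]]
      by (metis (no_types, lifting) eventually_happens' sequentially_bot)
    define b where
      "b n = ((real (n + m) + real (s N)) / real N * ln (real N) + real (n + m) / real N) / real n"
      for n
    have "b \<longlonglongrightarrow> inverse (real N) * ln (real N) + inverse (real N)"
      unfolding b_def using N(1) by real_asymp
    also have "inverse (real N) * ln (real N) + inverse (real N) = (ln (real N) + 1) / real N"
      by (simp add: add_divide_distrib divide_inverse algebra_simps)
    finally have "\<forall>\<^sub>F n in sequentially. b n < a"
      using N(2) by (rule order_tendstoD)
    then show "\<forall>\<^sub>F n in sequentially. ln (real (M n)) / real n < a"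
    proof eventually_elim
      case (elim n)
      have "ln (real (M n)) / real n \<le> b n"
        unfolding b_def by (intro divide_right_mono ln_M N(1)) simp
      with elim show ?case by simp
    qed
  qed
  then show ?thesis
    unfolding cover_entropy_def M_def by (rule limI)
qed

theorem mainTheorem3:
  fixes P :: "nat set"
  assumes "P \<subseteq> {1..}"
    and "topological_entropy (spacing_shift P) shift > 0"
  shows "Delta_star_set P"
proof (rule ccontr)
  assume "\<not> Delta_star_set P"
  then obtain D where D: "Delta_set D" "P \<inter> D = {}"
    using assms(1) by (auto simp: Delta_star_set_def)
  then obtain s where "strict_mono s" "differences s \<subseteq> D"
    by (auto simp: Delta_set_def)
  with D(2) have s: "strict_mono s" "P \<inter> differences s = {}"
    by blast+
  \<comment> \<open>A positive supremum forces some single cover to have positive entropy.\<close>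
  obtain \<U> where "open_cover (spacing_shift P) \<U>" "cover_entropy (spacing_shift P) shift \<U> > 0"
    using assms(2) by (auto simp: topological_entropy_def less_SUP_iff)
  then show False
    using cover_entropy_spacing_shift_eq_0[OF _ s] by simp
qed

end
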